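(* Let $X$ be a set. For all $a,b\in\mathcal{P}_X$, there exists $c\in\mathcal{P}_X$ with $a\supseteq c\leq b$ (that is, $a\,(\supseteq\circ\leq)\,b$) if and only if $a\mathbf{d}a\supseteq b\mathbf{d}b$.
   Context: The partition monoid $\mathcal{P}_X$ consists of all set partitions of the disjoint union $X\sqcup X=X_0\cup X_1$ of two copies of $X$. An element $a\in\mathcal{P}_X$ is identified with the graph on $X_0\cup X_1$ in which $\{i,j\}$ is an edge iff $i,j$ lie in the same block of $a$ (a union of cliques). Product: given $a,b\in\mathcal{P}_X$, regard $a$ as a graph on $X_0\cup X_1$ and $b$ as a graph on $X_1\cup X_2$ (with $X_0,X_1,X_2$ pairwise disjoint copies of $X$), and let $\Gamma$ be the union of these graphs on $X_0\cup X_1\cup X_2$; then $ab$ is the partition of $X_0\cup X_2$ (identified with $X\sqcup X$) in which $i,j\in X_0\cup X_2$ are in the same block iff there is a path in $\Gamma$ from $i$ to $j$. Inclusion order: $a\subseteq b$ iff every edge of $a$ is an edge of $b$ (i.e. $a$ refines $b$); $\supseteq$ is the reverse. The Mitsch order $\leq$ on any semigroup $S$ is: $a\leq b$ iff $a=b$ or there are $x,y\in S$ with $a=ax=bx=yb$; here $S=\mathcal{P}_X$. $\mathbf{d}\in\mathcal{P}_X$ is the trivial partition, all of whose blocks are singletons (discrete graph on $X\sqcup X$). *)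

theory Defs
  imports "HOL-Library.Disjoint_Sets" "HOL-Algebra.Group"
begin

text \<open>The two copies of \<open>X\<close> are realised by the disjoint sum \<open>X <+> X\<close>, with
  \<open>Inl\<close> for the copy indexed 0 and \<open>Inr\<close> for the copy indexed 1. The edge relation
  of a partition contains the loop at every vertex; this affects neither inclusion
  (all graphs compared have the same vertex set) nor connectedness.\<close>

definition edges :: "'v set set \<Rightarrow> 'v rel" where
  "edges a = {(i, j). \<exists>B\<in>a. i \<in> B \<and> j \<in> B}"

definition graph_le :: "'v set set \<Rightarrow> 'v set set \<Rightarrow> bool" (infix "\<sqsubseteq>\<^sub>g" 50) where
  "a \<sqsubseteq>\<^sub>g b \<longleftrightarrow> edges a \<subseteq> edges b"

text \<open>\<open>place m n\<close> puts the first copy of \<open>X\<close> on level \<open>m\<close> and the second on level \<open>n\<close>,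
  where level \<open>k\<close> is \<open>X \<times> {k}\<close>.\<close>

definition place :: "nat \<Rightarrow> nat \<Rightarrow> 'a + 'a \<Rightarrow> 'a \<times> nat" where
  "place m n = case_sum (\<lambda>x. (x, m)) (\<lambda>x. (x, n))"

definition product_graph :: "('a + 'a) set set \<Rightarrow> ('a + 'a) set set \<Rightarrow> ('a \<times> nat) rel" where
  "product_graph a b =
     map_prod (place 0 1) (place 0 1) ` edges a \<union> map_prod (place 1 2) (place 1 2) ` edges b"

definition partition_prod ::
    "'a set \<Rightarrow> ('a + 'a) set set \<Rightarrow> ('a + 'a) set set \<Rightarrow> ('a + 'a) set set" where
  "partition_prod X a b =
     (X <+> X) // {(i, j) \<in> (X <+> X) \<times> (X <+> X).
                    (place 0 2 i, place 0 2 j) \<in> (product_graph a b)\<^sup>*}"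

definition partition_monoid :: "'a set \<Rightarrow> ('a + 'a) set set monoid" where
  "partition_monoid X =
     \<lparr>carrier = {a. partition_on (X <+> X) a},
      mult = partition_prod X,
      one = (\<lambda>x. {Inl x, Inr x}) ` X\<rparr>"

definition discrete_partition :: "'a set \<Rightarrow> ('a + 'a) set set" where
  "discrete_partition X = (\<lambda>i. {i}) ` (X <+> X)"

definition mitsch_le :: "('s, 'm) monoid_scheme \<Rightarrow> 's \<Rightarrow> 's \<Rightarrow> bool" where
  "mitsch_le S a b \<longleftrightarrow>
     a = b \<or> (\<exists>x\<in>carrier S. \<exists>y\<in>carrier S.
                a = a \<otimes>\<^bsub>S\<^esub> x \<and> a = b \<otimes>\<^bsub>S\<^esub> x \<and> a = y \<otimes>\<^bsub>S\<^esub> b)"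

lemma sym_edges: "sym (edges a)"
  by (auto simp: sym_def edges_def)

lemma sym_product_graph: "sym (product_graph a b)"
proof -
  have "sym (map_prod f f ` edges c)" for f :: "'a + 'a \<Rightarrow> 'a \<times> nat" and c
  proof (rule symI)
    fix u v assume "(u, v) \<in> map_prod f f ` edges c"
    then obtain i j where ij: "(i, j) \<in> edges c" "u = f i" "v = f j" by auto
    then have "map_prod f f (j, i) \<in> map_prod f f ` edges c"
      by (intro imageI) (rule symD[OF sym_edges])
    then show "(v, u) \<in> map_prod f f ` edges c" using ij by simp
  qed
  then show ?thesis
    unfolding product_graph_def by (intro sym_Un)
qed

lemma partition_prod_closed: "partition_on (X <+> X) (partition_prod X a b)"
  unfolding partition_prod_def
proof (rule partition_on_quotient, rule equivI)
  note * = sym_rtrancl[OF sym_product_graph, THEN symD]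
  let ?r = "{(i, j) \<in> (X <+> X) \<times> (X <+> X).
               (place 0 2 i, place 0 2 j) \<in> (product_graph a b)\<^sup>*}"
  show "?r \<subseteq> (X <+> X) \<times> (X <+> X)" by blast
  show "refl_on (X <+> X) ?r" by (rule refl_onI) blast
  show "sym ?r" by (rule symI) (use * in blast)
  show "trans ?r" by (rule transI) (blast intro: rtrancl_trans)
qed

lemma discrete_partition_closed: "partition_on (X <+> X) (discrete_partition X)"
  by (rule partition_onI) (auto simp: discrete_partition_def disjnt_def)

lemma graph_le_iff_refines:
  assumes "partition_on A a" "partition_on A b"
  shows "a \<sqsubseteq>\<^sub>g b \<longleftrightarrow> refines A a b"
proof
  assume le: "a \<sqsubseteq>\<^sub>g b"
  have "\<exists>C\<in>b. B \<subseteq> C" if B: "B \<in> a" for B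
  proof -
    have "B \<noteq> {}" using B assms(1) by (auto simp: partition_on_def)
    then obtain i where i: "i \<in> B" by blast
    have e: "(i, j) \<in> edges b" if "j \<in> B" for j
      using le B i that unfolding graph_le_def edges_def by blast
    obtain C where C: "C \<in> b" "i \<in> C" using e[OF i] by (auto simp: edges_def)
    have "j \<in> C" if j: "j \<in> B" for j
    proof -
      obtain D where D: "D \<in> b" "i \<in> D" "j \<in> D" using e[OF j] by (auto simp: edges_def)
      then have "D = C" using C assms(2) unfolding partition_on_def disjoint_def by blast
      with D show ?thesis by simp
    qed
    then show ?thesis using C by blast
  qed
  then show "refines A a b" using assms by (simp add: refines_def)
next
  assume "refines A a b"
  then show "a \<sqsubseteq>\<^sub>g b" unfolding refines_def graph_le_def edges_def by blast
qed

end

theory Submission imports Defs begin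

text \<open>Since the middle factor \<open>\<^bold>d\<close> disconnects the two outer levels, \<open>b\<^bold>db\<close> keeps exactly those
  edges of \<open>b\<close> that join vertices of the same level. If \<open>c = bx = yb\<close>, then these edges all lie
  in \<open>c\<close>; conversely \<open>c = b\<^bold>db\<close> lies below \<open>b\<close> in the Mitsch order, with \<open>x = \<^bold>db\<close> and
  \<open>y = b\<^bold>d\<close>.\<close>

lemma edges_subset: "partition_on A p \<Longrightarrow> edges p \<subseteq> A \<times> A"
  by (auto simp: edges_def partition_on_def)

text \<open>A partition is the quotient by its edge relation, so the equations required by the
  Mitsch order can be checked on edge relations. In the other direction,
  \<open>edges_quotient\<close> recovers connectivity from the quotient that defines a
  product.\<close>

lemma edges_eq_iff:
  assumes "partition_on A p" "partition_on A q"
  shows "edges p = edges q \<longleftrightarrow> p = q"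
  using partition_on_eq_quotient[OF assms(1)] partition_on_eq_quotient[OF assms(2)]
  by (metis edges_def)

lemma equiv_edges: "partition_on A p \<Longrightarrow> equiv A (edges p)"
  unfolding edges_def by (rule equiv_partition_on)

lemma edges_quotient:
  assumes "equiv A r"
  shows "edges (A // r) = r"
proof -
  have "(i, j) \<in> r" if "B \<in> A // r" "i \<in> B" "j \<in> B" for B i j
    using that assms quotient_eq_iff by fastforce
  moreover have "\<exists>B\<in>A // r. i \<in> B \<and> j \<in> B" if "(i, j) \<in> r" for i j
    using that assms by (intro bexI[of _ "r `` {i}"])
      (auto simp: equiv_class_self quotientI equiv_class_eq_iff)
  ultimately show ?thesis by (auto simp: edges_def)
qed

lemma edges_discrete_partition: "edges (discrete_partition X) = Id_on (X <+> X)"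
  by (auto simp: edges_def discrete_partition_def)

lemma edges_partition_prod:
  "edges (partition_prod X p q) =
    {(i, j) \<in> (X <+> X) \<times> (X <+> X). (place 0 2 i, place 0 2 j) \<in> (product_graph p q)\<^sup>*}"
proof -
  note * = sym_rtrancl[OF sym_product_graph, THEN symD]
  show ?thesis
    unfolding partition_prod_def
  proof (intro edges_quotient equivI)
    let ?r = "{(i, j) \<in> (X <+> X) \<times> (X <+> X).
                 (place 0 2 i, place 0 2 j) \<in> (product_graph p q)\<^sup>*}"
    show "?r \<subseteq> (X <+> X) \<times> (X <+> X)" by blast
    show "refl_on (X <+> X) ?r" by (rule refl_onI) blast
    show "sym ?r" by (rule symI) (use * in blast)
    show "trans ?r" by (rule transI) (blast intro: rtrancl_trans)
  qed
qed

text \<open>\<open>place 0 1\<close> and \<open>place 0 2\<close> agree on \<open>Inl\<close>, so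
  the given edge is already a path of length one between outer vertices, whatever \<open>q\<close>
  is. The lower case is dual, with \<open>place 1 2\<close> and \<open>Inr\<close>.\<close>

lemma edges_partition_prod_upper:
  assumes "partition_on (X <+> X) p" "(Inl x, Inl y) \<in> edges p"
  shows "(Inl x, Inl y) \<in> edges (partition_prod X p q)"
proof -
  have "map_prod (place 0 1) (place 0 1) (Inl x, Inl y) \<in> product_graph p q"
    unfolding product_graph_def using assms(2) by blast
  then have "(place 0 2 (Inl x), place 0 2 (Inl y)) \<in> (product_graph p q)\<^sup>*"
    by (auto simp: place_def)
  with edges_subset[OF assms(1)] assms(2) show ?thesis
    unfolding edges_partition_prod by blast
qed

lemma edges_partition_prod_lower:
  assumes "partition_on (X <+> X) q" "(Inr x, Inr y) \<in> edges q"
  shows "(Inr x, Inr y) \<in> edges (partition_prod X p q)"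
proof -
  have "map_prod (place 1 2) (place 1 2) (Inr x, Inr y) \<in> product_graph p q"
    unfolding product_graph_def using assms(2) by blast
  then have "(place 0 2 (Inr x), place 0 2 (Inr y)) \<in> (product_graph p q)\<^sup>*"
    by (auto simp: place_def)
  with edges_subset[OF assms(1)] assms(2) show ?thesis
    unfolding edges_partition_prod by blast
qed

text \<open>Loops are included, so that upper edges of one partition together with lower edges of
  another can form the whole edge relation of a partition.\<close>

definition upper_edges :: "('a + 'a) set set \<Rightarrow> ('a + 'a) rel" where
  "upper_edges p = edges p \<inter> range Inl \<times> range Inl"

definition lower_edges :: "('a + 'a) set set \<Rightarrow> ('a + 'a) rel" where
  "lower_edges p = edges p \<inter> range Inr \<times> range Inr"

text \<open>Each alternative of \<open>sep\<close> says that one factor isolates every vertex of the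
  middle level. A path can then never cross that level: from the top it stays in a block of
  \<open>p\<close>, from the bottom in a block of \<open>q\<close>.\<close>

lemma edges_partition_prod_separated:
  assumes p: "partition_on (X <+> X) p" and q: "partition_on (X <+> X) q"
    and sep: "edges p `` range Inr \<subseteq> range Inr \<and> lower_edges p \<subseteq> Id \<or>
      edges q `` range Inl \<subseteq> range Inl \<and> upper_edges q \<subseteq> Id"
  shows "edges (partition_prod X p q) = upper_edges p \<union> lower_edges q"
proof -
  have trans_p: "(i, k) \<in> edges p" if "(i, j) \<in> edges p" "(j, k) \<in> edges p" for i j k
    using equiv_edges[OF p] that by (meson equivE transD)
  have trans_q: "(i, k) \<in> edges q" if "(i, j) \<in> edges q" "(j, k) \<in> edges q" for i j k
    using equiv_edges[OF q] that by (meson equivE transD)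
  have sym_p: "(j, i) \<in> edges p" if "(i, j) \<in> edges p" for i j
    using that sym_edges symD by metis
  have sym_q: "(j, i) \<in> edges q" if "(i, j) \<in> edges q" for i j
    using that sym_edges symD by metis
  have sep': "(\<forall>x i. (Inr x, i) \<in> edges p \<longrightarrow> i = Inr x) \<or>
      (\<forall>x i. (Inl x, i) \<in> edges q \<longrightarrow> i = Inl x)"
    using sep unfolding lower_edges_def upper_edges_def by blast
  \<comment> \<open>The end \<open>v\<close> may lie on any level, so that induction on the path
    applies; the invariant is that the path stays in the block of \<open>Inl x\<close> in
    \<open>p\<close>.\<close>
  have from_upper: "\<exists>j. v = place 0 1 j \<and> (Inl x, j) \<in> edges p"
    if path: "(place 0 2 (Inl x), v) \<in> (product_graph p q)\<^sup>*" and x: "x \<in> X" for x v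
    using path
  proof (induction rule: rtrancl_induct)
    case base
    then show ?case
      using equiv_edges[OF p] x
      by (intro exI[of _ "Inl x"]) (auto simp: place_def equiv_def refl_on_def)
  next
    case (step v w)
    then obtain j where j: "v = place 0 1 j" "(Inl x, j) \<in> edges p" by blast
    from step(2) consider
      (p) k l where "(k, l) \<in> edges p" "v = place 0 1 k" "w = place 0 1 l"
      | (q) k l where "(k, l) \<in> edges q" "v = place 1 2 k" "w = place 1 2 l"
      unfolding product_graph_def by auto
    then show ?case
    proof cases
      case p
      then have "k = j" using j by (auto simp: place_def split: sum.splits)
      then show ?thesis using p j trans_p by blast
    next
      case q
      then obtain y where "j = Inr y" "k = Inl y"
        using j by (auto simp: place_def split: sum.splits)
      \<comment> \<open>The path has reached the middle vertex \<open>Inr y\<close> through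
        \<open>p\<close>, so \<open>p\<close> does not isolate it. Hence \<open>q\<close> isolates
        the middle level and its edge is a loop.\<close>
      then have "l = k" using q j sep' sym_p by blast
      then show ?thesis using q j by metis
    qed
  qed
  have from_lower: "\<exists>j. v = place 1 2 j \<and> (Inr x, j) \<in> edges q"
    if path: "(place 0 2 (Inr x), v) \<in> (product_graph p q)\<^sup>*" and x: "x \<in> X" for x v
    using path
  proof (induction rule: rtrancl_induct)
    case base
    then show ?case
      using equiv_edges[OF q] x
      by (intro exI[of _ "Inr x"]) (auto simp: place_def equiv_def refl_on_def)
  next
    case (step v w)
    then obtain j where j: "v = place 1 2 j" "(Inr x, j) \<in> edges q" by blast
    from step(2) consider
      (p) k l where "(k, l) \<in> edges p" "v = place 0 1 k" "w = place 0 1 l"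
      | (q) k l where "(k, l) \<in> edges q" "v = place 1 2 k" "w = place 1 2 l"
      unfolding product_graph_def by auto
    then show ?case
    proof cases
      case p
      then obtain y where "j = Inl y" "k = Inr y"
        using j by (auto simp: place_def split: sum.splits)
      \<comment> \<open>Dually, \<open>q\<close> joins \<open>Inl y\<close> to \<open>Inr x\<close>,
        so it is \<open>p\<close> that isolates the middle level.\<close>
      then have "l = k" using p j sep' sym_q by blast
      then show ?thesis using p j by metis
    next
      case q
      then have "k = j" using j by (auto simp: place_def split: sum.splits)
      then show ?thesis using q j trans_q by blast
    qed
  qed
  show ?thesis
  proof (intro equalityI subrelI)
    fix i j assume ij: "(i, j) \<in> edges (partition_prod X p q)"
    then have *: "i \<in> X <+> X" "(place 0 2 i, place 0 2 j) \<in> (product_graph p q)\<^sup>*"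
      unfolding edges_partition_prod by auto
    show "(i, j) \<in> upper_edges p \<union> lower_edges q"
    proof (cases i)
      case (Inl x)
      then have "x \<in> X" using * by auto
      then obtain k where "place 0 2 j = place 0 1 k" "(Inl x, k) \<in> edges p"
        using from_upper * Inl by blast
      \<comment> \<open>Levels 0 and 2 on one side and 0 and 1 on the other share only level 0, so
        \<open>j\<close> lies in the upper copy.\<close>
      then show ?thesis
        using Inl by (auto simp: upper_edges_def place_def split: sum.splits)
    next
      case (Inr x)
      then have "x \<in> X" using * by auto
      then obtain k where "place 0 2 j = place 1 2 k" "(Inr x, k) \<in> edges q"
        using from_lower * Inr by blast
      then show ?thesis
        using Inr by (auto simp: lower_edges_def place_def split: sum.splits)
    qed
  next
    fix i j assume "(i, j) \<in> upper_edges p \<union> lower_edges q"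
    then show "(i, j) \<in> edges (partition_prod X p q)"
      using edges_partition_prod_upper[OF p] edges_partition_prod_lower[OF q]
      by (auto simp: upper_edges_def lower_edges_def)
  qed
qed

text \<open>The discrete partition isolates all its vertices, so as either factor it meets the
  separation condition.\<close>

lemma
  assumes "partition_on (X <+> X) p"
  shows edges_prod_discrete: "edges (partition_prod X p (discrete_partition X)) =
      upper_edges p \<union> lower_edges (discrete_partition X)"
    and edges_discrete_prod: "edges (partition_prod X (discrete_partition X) p) =
      upper_edges (discrete_partition X) \<union> lower_edges p"
  by (rule edges_partition_prod_separated[OF assms discrete_partition_closed];
      auto simp: upper_edges_def edges_discrete_partition)
     (rule edges_partition_prod_separated[OF discrete_partition_closed assms];
      auto simp: lower_edges_def edges_discrete_partition)

text \<open>A product with the discrete partition still isolates the copy of \<open>X\<close> that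
  this factor contributes, which becomes the middle level of the outer product. The first bracketing
  is that of the theorem; the second serves the right multiplier \<open>x\<close> of the Mitsch
  order.\<close>

lemma edges_prod_discrete_prod:
  assumes "partition_on (X <+> X) p" "partition_on (X <+> X) q"
  shows "edges (partition_prod X (partition_prod X p (discrete_partition X)) q) =
      upper_edges p \<union> lower_edges q"
    and "edges (partition_prod X p (partition_prod X (discrete_partition X) q)) =
      upper_edges p \<union> lower_edges q"
proof -
  note e = edges_prod_discrete[OF assms(1)] edges_discrete_prod[OF assms(2)]
  show "edges (partition_prod X (partition_prod X p (discrete_partition X)) q) =
      upper_edges p \<union> lower_edges q"
    by (subst edges_partition_prod_separated[OF partition_prod_closed assms(2)];
        auto simp: upper_edges_def lower_edges_def e edges_discrete_partition)
  show "edges (partition_prod X p (partition_prod X (discrete_partition X) q)) =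
      upper_edges p \<union> lower_edges q"
    by (subst edges_partition_prod_separated[OF assms(1) partition_prod_closed];
        auto simp: upper_edges_def lower_edges_def e edges_discrete_partition)
qed

lemma mitsch_le_prod_discrete_prod:
  assumes b: "partition_on (X <+> X) b"
  shows "mitsch_le (partition_monoid X)
    (partition_prod X (partition_prod X b (discrete_partition X)) b) b"
proof -
  let ?d = "discrete_partition X"
  let ?x = "partition_prod X ?d b" and ?y = "partition_prod X b ?d"
  let ?c = "partition_prod X ?y b"
  note c = partition_prod_closed[of X ?y b]
  note e = edges_prod_discrete_prod[OF b b]
  \<comment> \<open>Multiplying \<open>?c\<close> by \<open>?x\<close> keeps the upper edges of
    \<open>?c\<close> and takes the lower edges of \<open>b\<close>. As \<open>?c\<close> and
    \<open>b\<close> have the same upper edges, this gives back \<open>?c\<close>.\<close>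
  have "upper_edges ?c = upper_edges b"
    unfolding upper_edges_def[of ?c] e by (auto simp: upper_edges_def lower_edges_def)
  then have "edges (partition_prod X ?c ?x) = edges ?c"
    unfolding edges_prod_discrete_prod(2)[OF c b] e by simp
  then have cx: "?c = partition_prod X ?c ?x"
    by (metis edges_eq_iff partition_prod_closed)
  have bx: "?c = partition_prod X b ?x"
    using e by (metis edges_eq_iff partition_prod_closed)
  \<comment> \<open>The remaining equation, with left multiplier \<open>?y\<close>, holds by the
    definition of \<open>?c\<close>.\<close>
  show ?thesis
    unfolding mitsch_le_def partition_monoid_def using cx bx
    by (auto intro!: disjI2 bexI[of _ ?x] bexI[of _ ?y] partition_prod_closed)
qed

theorem proposition6p4:
  fixes X :: "'a set" and a b :: "('a + 'a) set set"
  assumes "a \<in> carrier (partition_monoid X)" and "b \<in> carrier (partition_monoid X)"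
  shows "(\<exists>c \<in> carrier (partition_monoid X). c \<sqsubseteq>\<^sub>g a \<and> mitsch_le (partition_monoid X) c b) \<longleftrightarrow>
    b \<otimes>\<^bsub>partition_monoid X\<^esub> discrete_partition X \<otimes>\<^bsub>partition_monoid X\<^esub> b \<sqsubseteq>\<^sub>g
    a \<otimes>\<^bsub>partition_monoid X\<^esub> discrete_partition X \<otimes>\<^bsub>partition_monoid X\<^esub> a"
proof -
  let ?M = "partition_monoid X" and ?d = "discrete_partition X"
  have a: "partition_on (X <+> X) a" and b: "partition_on (X <+> X) b"
    using assms by (simp_all add: partition_monoid_def)
  have mult: "p \<otimes>\<^bsub>?M\<^esub> q = partition_prod X p q" for p q
    by (simp add: partition_monoid_def)
  note ea = edges_prod_discrete_prod(1)[OF a a] and eb = edges_prod_discrete_prod(1)[OF b b]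
  show ?thesis
  proof
    assume "\<exists>c \<in> carrier ?M. c \<sqsubseteq>\<^sub>g a \<and> mitsch_le ?M c b"
    then obtain c where c: "edges c \<subseteq> edges a" "mitsch_le ?M c b"
      by (auto simp: graph_le_def)
    then consider "c = b" | x y where "c = partition_prod X b x" "c = partition_prod X y b"
      unfolding mitsch_le_def mult by blast
    then have "upper_edges b \<union> lower_edges b \<subseteq> edges c"
    proof cases
      case 1
      then show ?thesis by (auto simp: upper_edges_def lower_edges_def)
    next
      case 2
      \<comment> \<open>Each factorization yields one half: \<open>b\<close> as left factor
        preserves its upper edges, as right factor its lower ones.\<close>
      have "upper_edges b \<subseteq> edges c"
        unfolding 2(1) upper_edges_def using edges_partition_prod_upper[OF b] by blast
      moreover have "lower_edges b \<subseteq> edges c"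
        unfolding 2(2) lower_edges_def using edges_partition_prod_lower[OF b] by blast
      ultimately show ?thesis by blast
    qed
    \<comment> \<open>Edges of \<open>b\<close> within one level are thus edges of \<open>a\<close>
      within the same level, and these are the edges of the right-hand side.\<close>
    with c(1) show "b \<otimes>\<^bsub>?M\<^esub> ?d \<otimes>\<^bsub>?M\<^esub> b \<sqsubseteq>\<^sub>g a \<otimes>\<^bsub>?M\<^esub> ?d \<otimes>\<^bsub>?M\<^esub> a"
      unfolding graph_le_def mult ea eb by (auto simp: upper_edges_def lower_edges_def)
  next
    let ?c = "b \<otimes>\<^bsub>?M\<^esub> ?d \<otimes>\<^bsub>?M\<^esub> b"
    assume "?c \<sqsubseteq>\<^sub>g a \<otimes>\<^bsub>?M\<^esub> ?d \<otimes>\<^bsub>?M\<^esub> a"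
    \<comment> \<open>The bound on \<open>?c\<close> consists of upper and lower edges of
      \<open>a\<close>, so it refines \<open>a\<close>.\<close>
    then have "?c \<sqsubseteq>\<^sub>g a"
      unfolding graph_le_def mult ea by (auto simp: upper_edges_def lower_edges_def)
    moreover have "mitsch_le ?M ?c b"
      unfolding mult by (rule mitsch_le_prod_discrete_prod[OF b])
    moreover have "?c \<in> carrier ?M"
      by (simp add: partition_monoid_def partition_prod_closed)
    ultimately show "\<exists>c \<in> carrier ?M. c \<sqsubseteq>\<^sub>g a \<and> mitsch_le ?M c b" by blast
  qed
qed

end
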